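(* Let $c\in\mathbb{F}\setminus\{0\}$ and $f\in\mathbb{F}(\alpha_1,\ldots,\alpha_n)$, and let $\mathrm{Sol}_{c,f}$ be the set of all $g\in\mathbb{F}(\alpha_1,\ldots,\alpha_n)$ with $c\sigma(g)-g=f$. Let $g^*\in\mathrm{Sol}_{c,f}$. (1) If the homogeneous difference equation $c\sigma(g)-g=0$ has only the zero solution in $\mathbb{F}(\alpha_1,\ldots,\alpha_n)$, then $\mathrm{Sol}_{c,f}=\{g^*\}$. (2) If the homogeneous difference equation $c\sigma(g)-g=0$ has a nonzero solution $\widetilde g\in\mathbb{F}(\alpha_1,\ldots,\alpha_n)$, then $$\mathrm{Sol}_{c,f}=\{F\widetilde g+g^*\mid F\in\mathrm{Const}_\sigma\mathbb{F}(\alpha_1,\ldots,\alpha_n)\}.$$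
   Context: $\mathbb{F}$ is a subfield of $\overline{\mathbb{Q}}$, $n\ge1$, $\lambda_1,\ldots,\lambda_n\in\mathbb{F}\setminus\{0\}$, and $\sigma$ is the field automorphism of the rational function field $\mathbb{F}(\alpha_1,\ldots,\alpha_n)$ with $\sigma|_{\mathbb{F}}=\mathrm{id}$ and $\sigma(\alpha_i)=\lambda_i\alpha_i$ for $1\le i\le n$. $\mathrm{Const}_\sigma\mathbb{F}(\alpha_1,\ldots,\alpha_n)=\{h\in\mathbb{F}(\alpha_1,\ldots,\alpha_n)\mid\sigma(h)=h\}$. *)

theory Defs
  imports
    "HOL-Library.Poly_Mapping"
    "HOL-Computational_Algebra.Polynomial"
    "HOL-Computational_Algebra.Fraction_Field"
    "HOL-Algebra.Algebraic_Closure_Type"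
begin

text \<open>
  Polynomials in the variables \<open>\<alpha>\<^sub>i\<close> (\<open>i :: nat\<close>) are finitely supported maps from monomials to
  coefficients, a monomial being a finitely supported map from variable indices to exponents.
  The field \<open>\<F>(\<alpha>\<^sub>1, \<dots>, \<alpha>\<^sub>n)\<close>, for a subfield \<open>\<F>\<close> of the complex numbers, is carved out of the
  fraction field of the ring of all complex polynomials; this lets \<open>\<F>\<close> and \<open>n\<close> be ordinary variables.
\<close>

type_synonym cpoly = "(nat \<Rightarrow>\<^sub>0 nat) \<Rightarrow>\<^sub>0 complex"

type_synonym ratfun = "cpoly fract"

definition number_subfield :: "complex set \<Rightarrow> bool" where
  "number_subfield F \<longleftrightarrow>
     subfield F (ring_of_type_algebra :: complex ring) \<and> F \<subseteq> {z. algebraic z}"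

definition polys_over :: "complex set \<Rightarrow> nat \<Rightarrow> cpoly set" where
  "polys_over F n =
     {p. (\<forall>m. Poly_Mapping.lookup p m \<in> F) \<and> (\<forall>m\<in>Poly_Mapping.keys p. Poly_Mapping.keys m \<subseteq> {1..n})}"

definition ratfuns :: "complex set \<Rightarrow> nat \<Rightarrow> ratfun set" where
  "ratfuns F n = {Fract p q | p q. p \<in> polys_over F n \<and> q \<in> polys_over F n \<and> q \<noteq> 0}"

definition ratfun_field :: "complex set \<Rightarrow> nat \<Rightarrow> ratfun ring" where
  "ratfun_field F n = ring_of_type_algebra\<lparr>carrier := ratfuns F n\<rparr>"

definition const_rf :: "complex \<Rightarrow> ratfun" where
  "const_rf c = Fract (Poly_Mapping.single 0 c) 1"

definition var_rf :: "nat \<Rightarrow> ratfun" where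
  "var_rf i = Fract (Poly_Mapping.single (Poly_Mapping.single i 1) 1) 1"

text \<open>
  Only the values of \<open>\<sigma>\<close> on \<open>\<F>(\<alpha>\<^sub>1, \<dots>, \<alpha>\<^sub>n)\<close> are constrained, and there these conditions
  determine \<open>\<sigma>\<close>.
\<close>

definition scaling_automorphism ::
  "complex set \<Rightarrow> nat \<Rightarrow> (nat \<Rightarrow> complex) \<Rightarrow> (ratfun \<Rightarrow> ratfun) \<Rightarrow> bool" where
  "scaling_automorphism F n lam \<sigma> \<longleftrightarrow>
     \<sigma> \<in> ring_iso (ratfun_field F n) (ratfun_field F n) \<and>
     (\<forall>a\<in>F. \<sigma> (const_rf a) = const_rf a) \<and>
     (\<forall>i\<in>{1..n}. \<sigma> (var_rf i) = const_rf (lam i) * var_rf i)"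

definition Const :: "complex set \<Rightarrow> nat \<Rightarrow> (ratfun \<Rightarrow> ratfun) \<Rightarrow> ratfun set" where
  "Const F n \<sigma> = {h \<in> ratfuns F n. \<sigma> h = h}"

definition Sol ::
  "complex set \<Rightarrow> nat \<Rightarrow> (ratfun \<Rightarrow> ratfun) \<Rightarrow> complex \<Rightarrow> ratfun \<Rightarrow> ratfun set" where
  "Sol F n \<sigma> c f = {g \<in> ratfuns F n. const_rf c * \<sigma> g - g = f}"

end

theory Submission
  imports Defs
begin

text \<open>
  The equation \<open>c \<sigma>(g) - g = f\<close> is affine: \<open>\<sigma>\<close> is additive, so two solutions differ by a solution
  of the homogeneous equation \<open>c \<sigma>(g) = g\<close>. If that has only the zero solution, \<open>g\<^sup>*\<close> is the only
  solution. If it has a nonzero solution \<open>g'\<close>, then for every homogeneous solution \<open>d\<close> the quotient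
  \<open>d / g'\<close> is fixed by \<open>\<sigma>\<close>, because \<open>\<sigma>\<close> is multiplicative and both \<open>d\<close> and \<open>g'\<close> are multiplied by the
  same factor \<open>1 / c\<close>; conversely every \<open>\<sigma>\<close>-constant multiple of \<open>g'\<close> solves the homogeneous equation.
  So the homogeneous solutions form a line over the constants.

  This argument needs sums, differences, products and quotients of elements of
  \<open>\<F>(\<alpha>\<^sub>1, \<dots>, \<alpha>\<^sub>n)\<close> to be again in \<open>\<F>(\<alpha>\<^sub>1, \<dots>, \<alpha>\<^sub>n)\<close>, since \<open>\<sigma>\<close> is known to be a homomorphism only
  there. As that field is given as a subset of the fractions over all complex polynomials
  (\<open>ratfuns\<close>), closure is derived from the closure of \<open>polys_over\<close> under the ring operations.
\<close>

lemma number_subfield_closed: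
  assumes "number_subfield F"
  shows number_subfield_0: "0 \<in> F"
    and number_subfield_1: "1 \<in> F"
    and number_subfield_uminus: "a \<in> F \<Longrightarrow> - a \<in> F"
    and number_subfield_add: "a \<in> F \<Longrightarrow> b \<in> F \<Longrightarrow> a + b \<in> F"
    and number_subfield_mult: "a \<in> F \<Longrightarrow> b \<in> F \<Longrightarrow> a * b \<in> F"
proof -
  let ?C = "ring_of_type_algebra :: complex ring"
  have ring: "ring ?C"
    by (rule ring_from_type_algebra)
  have sub: "subring F ?C"
    using assms subfieldE(1) unfolding number_subfield_def by blast
  note E = subringE[OF sub]
  show "0 \<in> F" "1 \<in> F"
    using E(2,3) by (simp_all add: ring_of_type_algebra_def)
  show add: "a \<in> F \<Longrightarrow> b \<in> F \<Longrightarrow> a + b \<in> F" for a b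
    using E(7)[of a b] by (simp add: ring_of_type_algebra_def)
  show "a \<in> F \<Longrightarrow> b \<in> F \<Longrightarrow> a * b \<in> F"
    using E(6)[of a b] by (simp add: ring_of_type_algebra_def)
  show "- a \<in> F" if "a \<in> F"
  proof -
    let ?m = "\<ominus>\<^bsub>?C\<^esub> a"
    have "a \<oplus>\<^bsub>?C\<^esub> ?m = \<zero>\<^bsub>?C\<^esub>"
      using ring.ring_simprules(16)[OF ring, of a] by (simp add: ring_of_type_algebra_def)
    hence "a + ?m = 0"
      by (simp add: ring_of_type_algebra_def)
    hence "?m = - a"
      by (simp add: eq_neg_iff_add_eq_0 add.commute)
    thus ?thesis
      using E(5)[OF that] by simp
  qed
qed

lemma Sum_any_in_closed_set:
  assumes "0 \<in> F" and "\<And>a b. a \<in> F \<Longrightarrow> b \<in> F \<Longrightarrow> a + b \<in> F" and "\<And>x. f x \<in> F"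
  shows "Sum_any f \<in> F"
proof -
  have "sum f A \<in> F" for A
    by (induction A rule: infinite_finite_induct) (simp_all add: assms)
  thus ?thesis
    by (simp add: Sum_any.expand_set)
qed

lemma polys_over_0:
  assumes "number_subfield F"
  shows "0 \<in> polys_over F n"
  using number_subfield_0[OF assms] by (simp add: polys_over_def)

lemma polys_over_1:
  assumes "number_subfield F"
  shows "1 \<in> polys_over F n"
  using number_subfield_0[OF assms] number_subfield_1[OF assms]
  by (auto simp: polys_over_def lookup_one when_def)

lemma polys_over_uminus:
  assumes "number_subfield F" and "p \<in> polys_over F n"
  shows "- p \<in> polys_over F n"
  using assms(2) number_subfield_uminus[OF assms(1)] by (auto simp: polys_over_def keys_minus)

lemma polys_over_add:
  assumes "number_subfield F" and "p \<in> polys_over F n" and "q \<in> polys_over F n"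
  shows "p + q \<in> polys_over F n"
  using assms(2,3) number_subfield_add[OF assms(1)] keys_add[of p q]
  by (fastforce simp: polys_over_def lookup_add)

lemma polys_over_mult:
  assumes F: "number_subfield F" and p: "p \<in> polys_over F n" and q: "q \<in> polys_over F n"
  shows "p * q \<in> polys_over F n"
proof -
  note closed = number_subfield_0[OF F] number_subfield_add[OF F] number_subfield_mult[OF F]
  have "Poly_Mapping.lookup (p * q) m \<in> F" for m
    unfolding lookup_mult
    using p q closed
    by (auto simp: polys_over_def when_def intro!: Sum_any_in_closed_set closed(3))
  moreover have "Poly_Mapping.keys m \<subseteq> {1..n}" if "m \<in> Poly_Mapping.keys (p * q)" for m
  proof -
    obtain a b where "m = a + b" "a \<in> Poly_Mapping.keys p" "b \<in> Poly_Mapping.keys q"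
      using keys_mult[of p q] \<open>m \<in> Poly_Mapping.keys (p * q)\<close> by auto
    moreover from this have "Poly_Mapping.keys a \<subseteq> {1..n}" "Poly_Mapping.keys b \<subseteq> {1..n}"
      using p q unfolding polys_over_def by blast+
    ultimately show ?thesis
      using keys_add[of a b] by blast
  qed
  ultimately show ?thesis
    by (simp add: polys_over_def)
qed

lemma ratfunsE:
  assumes "g \<in> ratfuns F n"
  obtains p q where "g = Fract p q" "p \<in> polys_over F n" "q \<in> polys_over F n" "q \<noteq> 0"
  using assms unfolding ratfuns_def by blast

lemma ratfunsI:
  assumes "p \<in> polys_over F n" and "q \<in> polys_over F n" and "q \<noteq> 0"
  shows "Fract p q \<in> ratfuns F n"
  using assms unfolding ratfuns_def by blast

lemma ratfuns_uminus:
  assumes "number_subfield F" and "g \<in> ratfuns F n"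
  shows "- g \<in> ratfuns F n"
  using assms by (elim ratfunsE) (auto intro!: ratfunsI polys_over_uminus)

lemma ratfuns_add:
  assumes "number_subfield F" and "g \<in> ratfuns F n" and "h \<in> ratfuns F n"
  shows "g + h \<in> ratfuns F n"
  using assms by (elim ratfunsE) (auto intro!: ratfunsI polys_over_add polys_over_mult)

lemma ratfuns_diff:
  assumes "number_subfield F" and "g \<in> ratfuns F n" and "h \<in> ratfuns F n"
  shows "g - h \<in> ratfuns F n"
  using ratfuns_add[OF assms(1,2) ratfuns_uminus[OF assms(1,3)]] by simp

lemma ratfuns_mult:
  assumes "number_subfield F" and "g \<in> ratfuns F n" and "h \<in> ratfuns F n"
  shows "g * h \<in> ratfuns F n"
  using assms by (elim ratfunsE) (auto intro!: ratfunsI polys_over_mult)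

lemma ratfuns_inverse:
  assumes F: "number_subfield F" and "g \<in> ratfuns F n"
  shows "inverse g \<in> ratfuns F n"
proof -
  obtain p q where g: "g = Fract p q" "p \<in> polys_over F n" "q \<in> polys_over F n"
    using \<open>g \<in> ratfuns F n\<close> by (rule ratfunsE)
  show ?thesis
  proof (cases "p = 0")
    case True
    have "Fract 0 1 \<in> ratfuns F n"
      using F by (intro ratfunsI polys_over_0 polys_over_1) auto
    thus ?thesis
      using g True by (simp add: fract_collapse)
  next
    case False
    thus ?thesis
      using g by (simp add: ratfunsI)
  qed
qed

lemma ratfuns_divide:
  assumes "number_subfield F" and "g \<in> ratfuns F n" and "h \<in> ratfuns F n"
  shows "g / h \<in> ratfuns F n"
  using ratfuns_mult[OF assms(1,2) ratfuns_inverse[OF assms(1,3)]] by (simp add: divide_inverse)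

lemma scaling_automorphism_add:
  assumes "scaling_automorphism F n lam \<sigma>" and "g \<in> ratfuns F n" and "h \<in> ratfuns F n"
  shows "\<sigma> (g + h) = \<sigma> g + \<sigma> h"
  using assms
  by (simp add: scaling_automorphism_def ring_iso_def ring_hom_def ratfun_field_def
      ring_of_type_algebra_def)

lemma scaling_automorphism_mult:
  assumes "scaling_automorphism F n lam \<sigma>" and "g \<in> ratfuns F n" and "h \<in> ratfuns F n"
  shows "\<sigma> (g * h) = \<sigma> g * \<sigma> h"
  using assms
  by (simp add: scaling_automorphism_def ring_iso_def ring_hom_def ratfun_field_def
      ring_of_type_algebra_def)

lemma Sol_diff_homogeneous:
  assumes F: "number_subfield F" and aut: "scaling_automorphism F n lam \<sigma>"
    and g: "g \<in> Sol F n \<sigma> c f" and h: "h \<in> Sol F n \<sigma> c f"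
  shows "g - h \<in> ratfuns F n" and "const_rf c * \<sigma> (g - h) = g - h"
proof -
  have mem: "g \<in> ratfuns F n" "h \<in> ratfuns F n"
    using g h by (auto simp: Sol_def)
  show diff: "g - h \<in> ratfuns F n"
    using F mem by (rule ratfuns_diff)
  have "\<sigma> g = \<sigma> (g - h) + \<sigma> h"
    using scaling_automorphism_add[OF aut diff mem(2)] by simp
  hence "const_rf c * \<sigma> (g - h) = const_rf c * \<sigma> g - const_rf c * \<sigma> h"
    by (simp add: algebra_simps)
  also have "\<dots> = g - h"
    using g h by (simp add: Sol_def algebra_simps)
  finally show "const_rf c * \<sigma> (g - h) = g - h" .
qed

text \<open>
  From \<open>d = (d / g) g\<close> follows \<open>d = c \<sigma>(d) = \<sigma>(d / g) (c \<sigma>(g)) = \<sigma>(d / g) g\<close>; dividing by \<open>g\<close>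
  shows that \<open>\<sigma>\<close> fixes \<open>d / g\<close>.
\<close>

lemma homogeneous_quotient_in_Const:
  assumes F: "number_subfield F" and aut: "scaling_automorphism F n lam \<sigma>"
    and g: "g \<in> ratfuns F n" "g \<noteq> 0" "const_rf c * \<sigma> g = g"
    and d: "d \<in> ratfuns F n" "const_rf c * \<sigma> d = d"
  shows "d / g \<in> Const F n \<sigma>"
proof -
  have mem: "d / g \<in> ratfuns F n"
    using F d(1) g(1) by (rule ratfuns_divide)
  have "\<sigma> d = \<sigma> (d / g) * \<sigma> g"
    using scaling_automorphism_mult[OF aut mem g(1)] g(2) by simp
  hence "d = \<sigma> (d / g) * (const_rf c * \<sigma> g)"
    using d(2) by (simp add: ac_simps)
  hence "\<sigma> (d / g) = d / g"
    using g(2,3) by (simp add: eq_divide_eq)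
  thus ?thesis
    using mem by (simp add: Const_def)
qed

lemma Const_mult_homogeneous_add_Sol:
  assumes F: "number_subfield F" and aut: "scaling_automorphism F n lam \<sigma>"
    and h: "h \<in> Const F n \<sigma>"
    and g: "g \<in> ratfuns F n" "const_rf c * \<sigma> g = g"
    and s: "s \<in> Sol F n \<sigma> c f"
  shows "h * g + s \<in> Sol F n \<sigma> c f"
proof -
  have h': "h \<in> ratfuns F n" "\<sigma> h = h" and s': "s \<in> ratfuns F n" "const_rf c * \<sigma> s - s = f"
    using h s by (auto simp: Const_def Sol_def)
  have hg: "h * g \<in> ratfuns F n"
    using F h'(1) g(1) by (rule ratfuns_mult)
  have "const_rf c * \<sigma> (h * g + s) = h * (const_rf c * \<sigma> g) + const_rf c * \<sigma> s"
    unfolding scaling_automorphism_add[OF aut hg s'(1)]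
      scaling_automorphism_mult[OF aut h'(1) g(1)] h'(2)
    by (simp add: algebra_simps)
  thus ?thesis
    using ratfuns_add[OF F hg s'(1)] g(2) s'(2) by (simp add: Sol_def algebra_simps)
qed

theorem theorem4p1:
  fixes F :: "complex set" and n :: nat and lam :: "nat \<Rightarrow> complex"
    and \<sigma> :: "ratfun \<Rightarrow> ratfun" and c :: complex and f gs :: ratfun
  assumes "number_subfield F"
    and "n \<ge> 1"
    and "\<forall>i\<in>{1..n}. lam i \<in> F - {0}"
    and "scaling_automorphism F n lam \<sigma>"
    and "c \<in> F - {0}"
    and "f \<in> ratfuns F n"
    and "gs \<in> Sol F n \<sigma> c f"
  shows "((\<forall>g\<in>ratfuns F n. const_rf c * \<sigma> g - g = 0 \<longrightarrow> g = 0) \<longrightarrow> Sol F n \<sigma> c f = {gs}) \<and>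
         (\<forall>gt\<in>ratfuns F n. gt \<noteq> 0 \<and> const_rf c * \<sigma> gt - gt = 0 \<longrightarrow>
            Sol F n \<sigma> c f = {h * gt + gs | h. h \<in> Const F n \<sigma>})"
proof (intro conjI impI ballI)
  note F = assms(1) and aut = assms(4) and gs = assms(7)
  note diff = Sol_diff_homogeneous[OF F aut _ gs]
  show "Sol F n \<sigma> c f = {gs}"
    if trivial: "\<forall>g\<in>ratfuns F n. const_rf c * \<sigma> g - g = 0 \<longrightarrow> g = 0"
  proof -
    have "g = gs" if "g \<in> Sol F n \<sigma> c f" for g
    proof -
      have "g - gs = 0"
        using trivial diff[OF that] by (metis diff_self)
      thus ?thesis
        by simp
    qed
    thus ?thesis
      using gs by blast
  qed
  show "Sol F n \<sigma> c f = {h * gt + gs | h. h \<in> Const F n \<sigma>}"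
    if gt: "gt \<in> ratfuns F n" and gt': "gt \<noteq> 0 \<and> const_rf c * \<sigma> gt - gt = 0" for gt
  proof (intro equalityI subsetI)
    fix g assume g: "g \<in> Sol F n \<sigma> c f"
    have "(g - gs) / gt \<in> Const F n \<sigma>"
      using homogeneous_quotient_in_Const[OF F aut gt _ _ diff[OF g]] gt' by simp
    moreover have "g = (g - gs) / gt * gt + gs"
      using gt' by simp
    ultimately show "g \<in> {h * gt + gs | h. h \<in> Const F n \<sigma>}"
      by blast
  next
    fix g assume "g \<in> {h * gt + gs | h. h \<in> Const F n \<sigma>}"
    thus "g \<in> Sol F n \<sigma> c f"
      using Const_mult_homogeneous_add_Sol[OF F aut _ gt _ gs] gt' by auto
  qed
qed

end
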